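(* Let $n\ge 3$ be an integer and let $a,b,c\in\mathbb{R}$. The circulant matrix $\mathrm{Circ}(a,b,c,\ldots,c)\in\mathcal{M}_n(\mathbb{R})$ (first row: $a$, then $b$, then $n-2$ entries equal to $c$) is invertible if and only if $$\big[a+b+(n-2)c\big]\big[(a-b)^2+\big(1-(-1)^n\big)(c-b)^2\big]\neq 0,$$ and in that case $\mathrm{Circ}(a,b,c,\ldots,c)^{-1}=\mathrm{Circ}\big(k_1,\ldots,k_n\big)$, where $k_j=k_j(a,b,c)$ is given as follows. If $a\neq 2c-b$, then $$k_j(a,b,c)=\frac{(c-b)^{j-1}(a-c)^{n-j}}{(a-c)^n-(c-b)^n}-\frac{c}{(a+b-2c)\big(a+b+(n-2)c\big)},\qquad j=1,\ldots,n,$$ and if $a=2c-b$, then $$k_j(2c-b,b,c)=\frac{1}{n}\Big[\frac{1}{nc}+\frac{n-1}{2(c-b)}\Big]-\frac{j-1}{n(c-b)},\qquad j=1,\ldots,n.$$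
   Context: For $(a_1,\ldots,a_n)\in\mathbb{R}^n$, $\mathrm{Circ}(a_1,\ldots,a_n)\in\mathcal{M}_n(\mathbb{R})$ denotes the circulant matrix whose $(i,j)$ entry is $a_{1+((j-i)\bmod n)}$; its first row is $(a_1,\ldots,a_n)$ and each row is the cyclic right shift of the previous one. The convention $0^0=1$ is used. *)

theory Defs
  imports "Jordan_Normal_Form.Matrix"
begin

text \<open>The circulant matrix with first row \<open>xs\<close>. Lists and matrix indices are 0-based, so the entry
  in position \<open>(i, j)\<close> is \<open>xs ! ((j - i) mod n)\<close>; the residue is taken over \<open>int\<close>, where it lies in
  \<open>{0..<n}\<close> also for \<open>j < i\<close>.\<close>

definition circ :: "'a list \<Rightarrow> 'a mat" where
  "circ xs = (let n = length xs in
     mat n n (\<lambda>(i, j). xs ! nat ((int j - int i) mod int n)))"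

text \<open>The coefficients \<open>k\<^sub>j(a,b,c)\<close>, with \<open>j\<close> ranging over \<open>1, \<dots>, n\<close>; for such \<open>j\<close> the natural number
  subtractions in the exponents do not truncate. The convention \<open>0\<^sup>0 = 1\<close> is built into \<open>power\<close>.\<close>

definition circ_inv_coeff :: "nat \<Rightarrow> real \<Rightarrow> real \<Rightarrow> real \<Rightarrow> nat \<Rightarrow> real" where
  "circ_inv_coeff n a b c j =
     (if a \<noteq> 2 * c - b then
        (c - b) ^ (j - 1) * (a - c) ^ (n - j) / ((a - c) ^ n - (c - b) ^ n)
          - c / ((a + b - 2 * c) * (a + b + (real n - 2) * c))
      else
        1 / real n * (1 / (real n * c) + (real n - 1) / (2 * (c - b)))
          - (real j - 1) / (real n * (c - b)))"

end

theory Submission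
  imports Defs "Jordan_Normal_Form.Determinant"
begin

text \<open>
  Write \<open>x = a - c\<close> and \<open>y = c - b\<close>, let \<open>P\<close> be the cyclic shift, \<open>P = circ [0, 1, 0, \<dots>, 0]\<close>, and
  \<open>J\<close> the all-ones matrix. The matrix of the theorem is \<open>A = x I - y P + c J\<close>: a two-term cyclic
  recurrence plus a rank-one term, which acts on a column through its sum only
  (\<open>circ_two_const_mult_column\<close>).

  For the inverse, \<open>A * circ ks = I\<close> therefore says that
  \<open>x * ks\<^sub>r - y * ks\<^sub>r\<^sub>-\<^sub>1 + c * sum ks\<close> is \<open>1\<close> for \<open>r = 0\<close> and \<open>0\<close> for the other residues \<open>r\<close>
  modulo \<open>n\<close> (\<open>circ_two_const_right_inverse\<close>). If \<open>x \<noteq> y\<close>, the geometric sequence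
  \<open>y\<^sup>r x\<^sup>n\<^sup>-\<^sup>1\<^sup>-\<^sup>r\<close> satisfies \<open>x g\<^sub>r = y g\<^sub>r\<^sub>-\<^sub>1\<close> except at the wrap-around, where the defect is
  \<open>x\<^sup>n - y\<^sup>n\<close>; dividing by this number inverts \<open>x I - y P\<close>, and a constant shift then absorbs
  the contribution of \<open>c J\<close>. If \<open>x = y \<noteq> 0\<close>, the operator \<open>x (I - P)\<close> has the constants as its kernel,
  and an arithmetic progression solves the recurrence up to the constant \<open>-1/n\<close>, which
  \<open>c J\<close> has to supply.

  For singularity, \<open>1 - (-1)\<^sup>n\<close> vanishes for even \<open>n\<close> and is \<open>2\<close> for odd \<open>n\<close>. So the product in the
  criterion is zero in exactly three cases, each with an evident kernel vector: the all-ones vector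
  if the row sum is zero, the alternating vector if \<open>a = b\<close> and \<open>n\<close> is even, and
  \<open>(1, -1, 0, \<dots>, 0)\<close> if \<open>a = b = c\<close>. In all other cases the recurrence above can be solved.
\<close>

section \<open>Products with circulants of the form x I - y P + c J\<close>

lemma circ_carrier: "circ xs \<in> carrier_mat (length xs) (length xs)"
  by (simp add: circ_def Let_def)

lemma circ_index:
  assumes "i < length xs" "j < length xs"
  shows "circ xs $$ (i, j) = xs ! nat ((int j - int i) mod int (length xs))"
  using assms by (simp add: circ_def Let_def)

lemma circ_two_const_index:
  fixes a b c :: "'a :: comm_ring_1"
  assumes "n \<ge> 2" "i < n" "l < n"
  shows "circ (a # b # replicate (n - 2) c) $$ (i, l) =
           (if l = i then a - c else 0) - (if l = Suc i mod n then c - b else 0) + c"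
proof -
  define r where "r = nat ((int l - int i) mod int n)"
  have r: "r = (if i \<le> l then l - i else n + l - i)"
  proof (cases "i \<le> l")
    case True
    then have "(int l - int i) mod int n = int l - int i"
      using assms by (intro mod_pos_pos_trivial) auto
    then show ?thesis using True by (simp add: r_def)
  next
    case False
    have "(int l - int i) mod int n = (int l - int i + int n) mod int n"
      by simp
    also have "\<dots> = int l - int i + int n"
      using False assms by (intro mod_pos_pos_trivial) auto
    finally show ?thesis using False by (simp add: r_def)
  qed
  have s: "Suc i mod n = (if Suc i = n then 0 else Suc i)"
    using assms by auto
  have "r < n" "r = 0 \<longleftrightarrow> l = i" "r = 1 \<longleftrightarrow> l = Suc i mod n"
    using assms unfolding r s by auto
  moreover have "(a # b # replicate (n - 2) c) ! r = (if r = 0 then a else if r = 1 then b else c)"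
    using \<open>r < n\<close> by (auto simp: nth_Cons split: nat.split)
  ultimately show ?thesis
    using assms by (auto simp: circ_index r_def)
qed

lemma circ_two_const_mult_column:
  fixes a b c :: "'a :: comm_ring_1"
  assumes "n \<ge> 2" "i < n"
  shows "(\<Sum>l<n. circ (a # b # replicate (n - 2) c) $$ (i, l) * f l) =
           (a - c) * f i - (c - b) * f (Suc i mod n) + c * (\<Sum>l<n. f l)"
proof -
  have "(\<Sum>l<n. circ (a # b # replicate (n - 2) c) $$ (i, l) * f l) =
        (\<Sum>l<n. (if l = i then (a - c) * f l else 0)
              - (if l = Suc i mod n then (c - b) * f l else 0) + c * f l)"
    using assms by (intro sum.cong) (auto simp: circ_two_const_index algebra_simps)
  also have "\<dots> = (a - c) * f i - (c - b) * f (Suc i mod n) + c * (\<Sum>l<n. f l)"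
    using assms by (simp add: sum.distrib sum_subtractf sum_distrib_left)
  finally show ?thesis .
qed

text \<open>Each column of a circulant runs once through its first row, so all its column sums agree.\<close>

lemma circ_column_sum:
  assumes "length ks = n" "j < n"
  shows "(\<Sum>l<n. circ ks $$ (l, j)) = sum_list ks"
proof -
  have involution: "nat ((int j - (int j - int l) mod int n) mod int n) = l" if "l < n" for l
  proof -
    have "(int j - (int j - int l) mod int n) mod int n = (int j - (int j - int l)) mod int n"
      by (simp only: mod_diff_right_eq)
    then show ?thesis using that by simp
  qed
  have "(\<Sum>l<n. circ ks $$ (l, j)) = (\<Sum>r<n. ks ! r)"
    using assms
    by (intro sum.reindex_bij_witness[where i = "\<lambda>r. nat ((int j - int r) mod int n)"
          and j = "\<lambda>r. nat ((int j - int r) mod int n)"])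
      (simp_all add: involution circ_index nat_less_iff)
  then show ?thesis
    using assms by (simp add: sum_list_sum_nth atLeast0LessThan)
qed

text \<open>The product is again constant along cyclic diagonals, so a single recurrence on the first row of
  the second factor decides whether it is the identity.\<close>

lemma circ_two_const_right_inverse:
  fixes a b c :: "'a :: comm_ring_1"
  assumes n: "n \<ge> 2" and len: "length ks = n"
    and rec: "\<And>r. r < n \<Longrightarrow>
      (a - c) * ks ! r - (c - b) * ks ! (if r = 0 then n - 1 else r - 1) + c * sum_list ks =
      (if r = 0 then 1 else 0)"
  shows "circ (a # b # replicate (n - 2) c) * circ ks = 1\<^sub>m n"
proof (rule eq_matI)
  let ?A = "circ (a # b # replicate (n - 2) c)"
  have A: "?A \<in> carrier_mat n n" and K: "circ ks \<in> carrier_mat n n"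
    using circ_carrier[of "a # b # replicate (n - 2) c"] circ_carrier[of ks] n len by auto
  show "dim_row (?A * circ ks) = dim_row (1\<^sub>m n)" "dim_col (?A * circ ks) = dim_col (1\<^sub>m n)"
    using A K by auto
  fix i j assume "i < dim_row (1\<^sub>m n :: 'a mat)" "j < dim_col (1\<^sub>m n :: 'a mat)"
  then have ij: "i < n" "j < n" by auto
  define r where "r = nat ((int j - int i) mod int n)"
  have r: "r < n" using n by (simp add: r_def nat_less_iff)
  have int_r: "int r = (int j - int i) mod int n" using n by (simp add: r_def)
  have r0: "r = 0 \<longleftrightarrow> i = j"
  proof
    assume "r = 0"
    then have "int n dvd int j - int i" using int_r by (simp add: dvd_eq_mod_eq_0)
    then have "int j mod int n = int i mod int n" by (simp add: mod_eq_dvd_iff)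
    then show "i = j" using ij by simp
  qed (simp add: r_def)
  \<comment> \<open>Moving down one row of a circulant decreases the residue by one, with wrap-around.\<close>
  have step: "nat ((int j - int (Suc i mod n)) mod int n) = (if r = 0 then n - 1 else r - 1)"
  proof -
    have "(int j - int (Suc i mod n)) mod int n = (int j - int (Suc i)) mod int n"
      by (metis mod_diff_right_eq zmod_int)
    also have "\<dots> = ((int j - int i) - 1) mod int n" by (simp add: algebra_simps)
    also have "\<dots> = (int r - 1) mod int n" by (simp add: int_r mod_diff_left_eq)
    also have "\<dots> = (if r = 0 then int n - 1 else int r - 1)"
      using r by (auto simp: zmod_minus1)
    finally show ?thesis using n by auto
  qed
  have "(?A * circ ks) $$ (i, j) = (\<Sum>l<n. ?A $$ (i, l) * circ ks $$ (l, j))"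
    using ij A K by (simp add: scalar_prod_def atLeast0LessThan)
  also have "\<dots> = (a - c) * circ ks $$ (i, j) - (c - b) * circ ks $$ (Suc i mod n, j)
      + c * sum_list ks"
    using circ_two_const_mult_column[OF n ij(1), of a b c "\<lambda>l. circ ks $$ (l, j)"]
      circ_column_sum[OF len ij(2)] by simp
  also have "\<dots> = (if r = 0 then 1 else 0)"
    using rec[OF r] ij len n step by (simp add: circ_index r_def)
  finally show "(?A * circ ks) $$ (i, j) = 1\<^sub>m n $$ (i, j)"
    using ij r0 by simp
qed

lemma circ_two_const_singular:
  fixes a b c :: "'a :: field"
  assumes n: "n \<ge> 2" and nz: "j < n" "f j \<noteq> 0"
    and ker: "\<And>i. i < n \<Longrightarrow> (a - c) * f i - (c - b) * f (Suc i mod n) + c * (\<Sum>l<n. f l) = 0"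
  shows "\<not> invertible_mat (circ (a # b # replicate (n - 2) c))"
proof
  let ?A = "circ (a # b # replicate (n - 2) c)"
  have A: "?A \<in> carrier_mat n n"
    using circ_carrier[of "a # b # replicate (n - 2) c"] n by auto
  assume "invertible_mat ?A"
  then obtain B where B: "B * ?A = 1\<^sub>m (dim_row B)" "?A * B = 1\<^sub>m (dim_row ?A)"
    by (auto simp: invertible_mat_def inverts_mat_def)
  have "dim_col (B * ?A) = dim_row B" "dim_col (?A * B) = dim_row ?A"
    by (simp_all add: B)
  then have Bc: "B \<in> carrier_mat n n" using A by auto
  have v: "vec n f \<in> carrier_vec n" by simp
  have "?A *\<^sub>v vec n f = 0\<^sub>v n"
  proof (rule eq_vecI)
    fix i assume "i < dim_vec (0\<^sub>v n :: 'a vec)"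
    then have i: "i < n" by simp
    have "(?A *\<^sub>v vec n f) $ i = (\<Sum>l<n. ?A $$ (i, l) * f l)"
      using i A by (simp add: scalar_prod_def atLeast0LessThan)
    then show "(?A *\<^sub>v vec n f) $ i = 0\<^sub>v n $ i"
      using circ_two_const_mult_column[OF n i, of a b c f] ker[OF i] i by simp
  qed (use A in simp)
  then have "(B * ?A) *\<^sub>v vec n f = B *\<^sub>v 0\<^sub>v n"
    using assoc_mult_mat_vec[OF Bc A v] by simp
  also have "\<dots> = 0\<^sub>v n" using Bc by (intro eq_vecI) auto
  finally have "vec n f = 0\<^sub>v n" using B Bc by simp
  then have "vec n f $ j = 0\<^sub>v n $ j" by simp
  with nz show False by simp
qed

section \<open>The coefficients of the inverse\<close>

text \<open>Why the denominator in the formula for \<open>k\<^sub>j\<close> is nonzero: two distinct reals have equal \<open>n\<close>-th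
  powers only if \<open>n\<close> is even and they are opposite, and \<open>a - c = -(c - b)\<close> says \<open>a = b\<close>.\<close>

lemma real_power_eq_imp_opposite:
  fixes x y :: real
  assumes "x ^ n = y ^ n" "x \<noteq> y" "n > 0"
  shows "even n \<and> x = - y"
proof (cases "even n")
  case True
  then have "\<bar>x\<bar> = \<bar>y\<bar>"
    using assms power_eq_imp_eq_base[of "\<bar>x\<bar>" n "\<bar>y\<bar>"] by (simp add: power_even_abs)
  then show ?thesis using True assms by auto
next
  case False
  then show ?thesis using assms odd_real_root_unique by metis
qed

lemma sum_list_circ_inv_coeff:
  "sum_list (map (circ_inv_coeff n a b c) [1..<n + 1]) = (\<Sum>r<n. circ_inv_coeff n a b c (Suc r))"
  by (simp add: sum_list_sum_nth atLeast0LessThan del: upt_Suc)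

text \<open>With \<open>x = a - c\<close>, \<open>y = c - b\<close> and \<open>s = x - y + n c\<close>, the row sum of the matrix, the
  geometric terms add up to \<open>1/(x - y)\<close> by the factorization of \<open>x\<^sup>n - y\<^sup>n\<close>, and taking away the
  constant \<open>c/((x - y) s)\<close> \<open>n\<close> times leaves \<open>1/s\<close>. No other value is possible, since inverse
  circulants have reciprocal row sums.\<close>

lemma sum_circ_inv_coeff_generic:
  fixes a b c :: real
  assumes "n > 0" "a \<noteq> 2 * c - b" "(a - c) ^ n \<noteq> (c - b) ^ n" "a + b + (real n - 2) * c \<noteq> 0"
  shows "(\<Sum>r<n. circ_inv_coeff n a b c (Suc r)) = 1 / (a + b + (real n - 2) * c)"
proof -
  define x y where "x = a - c" and "y = c - b"
  define s where "s = a + b + (real n - 2) * c"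
  have s: "s = (x - y) + real n * c"
    by (simp add: x_def y_def s_def algebra_simps)
  have nz: "x - y \<noteq> 0" "x ^ n - y ^ n \<noteq> 0" "s \<noteq> 0"
    using assms by (auto simp: x_def y_def s_def)
  have geom: "x ^ n - y ^ n = (x - y) * (\<Sum>r<n. y ^ r * x ^ (n - Suc r))"
  proof -
    have "x ^ n - y ^ n = - (y ^ n - x ^ n)" by simp
    also have "\<dots> = - ((y - x) * (\<Sum>r<n. x ^ (n - Suc r) * y ^ r))"
      by (simp only: power_diff_sumr2)
    also have "\<dots> = (x - y) * (\<Sum>r<n. y ^ r * x ^ (n - Suc r))"
      by (simp add: algebra_simps)
    finally show ?thesis .
  qed
  have "(\<Sum>r<n. circ_inv_coeff n a b c (Suc r)) =
        (\<Sum>r<n. y ^ r * x ^ (n - Suc r) / (x ^ n - y ^ n) - c / ((x - y) * s))"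
    using assms(2) by (simp add: circ_inv_coeff_def x_def y_def s_def)
  also have "\<dots> = (\<Sum>r<n. y ^ r * x ^ (n - Suc r)) / (x ^ n - y ^ n) - real n * (c / ((x - y) * s))"
    by (simp add: sum_subtractf sum_divide_distrib)
  also have "(\<Sum>r<n. y ^ r * x ^ (n - Suc r)) / (x ^ n - y ^ n) = 1 / (x - y)"
    using geom nz by (simp add: field_simps)
  also have "1 / (x - y) - real n * (c / ((x - y) * s)) = (s - real n * c) / ((x - y) * s)"
    using nz by (simp add: diff_divide_distrib)
  also have "\<dots> = 1 / s" using nz s by simp
  finally show ?thesis by (simp add: s_def)
qed

lemma sum_circ_inv_coeff_arith:
  fixes a b c :: real
  assumes "n > 0" "a = 2 * c - b" "c \<noteq> b" "c \<noteq> 0"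
  shows "(\<Sum>r<n. circ_inv_coeff n a b c (Suc r)) = 1 / (real n * c)"
proof -
  have gauss: "(\<Sum>r<n. real r) = real n * (real n - 1) / 2"
    by (induction n) (auto simp: field_simps)
  have nz: "real n \<noteq> 0" "c - b \<noteq> 0" using assms by auto
  have "(\<Sum>r<n. circ_inv_coeff n a b c (Suc r)) =
        (\<Sum>r<n. 1 / real n * (1 / (real n * c) + (real n - 1) / (2 * (c - b)))
               - real r / (real n * (c - b)))"
    using assms(2) by (simp add: circ_inv_coeff_def)
  also have "\<dots> = (1 / (real n * c) + (real n - 1) / (2 * (c - b)))
      - (\<Sum>r<n. real r) / (real n * (c - b))"
    using nz by (simp add: sum_subtractf sum_divide_distrib)
  also have "(\<Sum>r<n. real r) / (real n * (c - b)) = (real n - 1) / (2 * (c - b))"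
    unfolding gauss using nz by (simp add: field_simps)
  finally show ?thesis by simp
qed

text \<open>Below, \<open>q\<close> is the cyclic predecessor of \<open>r\<close>. The geometric parts of the two coefficients
  cancel unless \<open>r = 0\<close>; their constant parts leave \<open>-c/s\<close>, which cancels \<open>c\<close> times the total
  \<open>1/s\<close>.\<close>

lemma circ_inv_coeff_rec_generic:
  fixes a b c :: real
  assumes "r < n" "a \<noteq> 2 * c - b" "(a - c) ^ n \<noteq> (c - b) ^ n" "a + b + (real n - 2) * c \<noteq> 0"
  shows "(a - c) * circ_inv_coeff n a b c (Suc r)
           - (c - b) * circ_inv_coeff n a b c (Suc (if r = 0 then n - 1 else r - 1))
           + c * (\<Sum>r<n. circ_inv_coeff n a b c (Suc r)) = (if r = 0 then 1 else 0)"
proof -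
  define x y where "x = a - c" and "y = c - b"
  define s where "s = a + b + (real n - 2) * c"
  define q where "q = (if r = 0 then n - 1 else r - 1)"
  have nz: "x - y \<noteq> 0" "x ^ n - y ^ n \<noteq> 0" "s \<noteq> 0"
    using assms by (auto simp: x_def y_def s_def)
  have k: "circ_inv_coeff n a b c (Suc t) =
      y ^ t * x ^ (n - Suc t) / (x ^ n - y ^ n) - c / ((x - y) * s)" for t
    using assms(2) by (simp add: circ_inv_coeff_def x_def y_def s_def)
  have total: "(\<Sum>r<n. circ_inv_coeff n a b c (Suc r)) = 1 / s"
    using sum_circ_inv_coeff_generic[of n a c b] assms by (simp add: s_def)
  have defect: "x * (y ^ r * x ^ (n - Suc r)) - y * (y ^ q * x ^ (n - Suc q)) =
      (if r = 0 then x ^ n - y ^ n else 0)"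
  proof (cases r)
    case 0
    then show ?thesis
      using assms(1) by (cases n) (simp_all add: q_def)
  next
    case (Suc t)
    have "x ^ (n - Suc t) = x * x ^ (n - Suc (Suc t))"
      using assms(1) Suc by (simp add: Suc_diff_Suc flip: power_Suc)
    then show ?thesis using Suc by (simp add: q_def algebra_simps)
  qed
  have "x * (y ^ r * x ^ (n - Suc r) / (x ^ n - y ^ n) - c / ((x - y) * s))
      - y * (y ^ q * x ^ (n - Suc q) / (x ^ n - y ^ n) - c / ((x - y) * s)) + c * (1 / s) =
      (x * (y ^ r * x ^ (n - Suc r)) - y * (y ^ q * x ^ (n - Suc q))) / (x ^ n - y ^ n)
      - (x - y) * (c / ((x - y) * s)) + c / s"
    by (simp add: diff_divide_distrib algebra_simps)
  also have "\<dots> = (if r = 0 then 1 else 0)"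
    unfolding defect using nz by simp
  finally show ?thesis
    unfolding total unfolding k q_def[symmetric] x_def[symmetric] y_def[symmetric]
      s_def[symmetric] .
qed

text \<open>Here \<open>a - c = c - b\<close>, so only the difference of cyclically adjacent coefficients matters. The
  progression contributes \<open>-1/n\<close> at each step and \<open>(n - 1)/n\<close> at the wrap-around; the additive
  constant in \<open>k\<^sub>j\<close> is chosen so that \<open>c\<close> times the total is the missing \<open>1/n\<close>.\<close>

lemma circ_inv_coeff_rec_arith:
  fixes a b c :: real
  assumes "r < n" "a = 2 * c - b" "c \<noteq> b" "c \<noteq> 0"
  shows "(a - c) * circ_inv_coeff n a b c (Suc r)
           - (c - b) * circ_inv_coeff n a b c (Suc (if r = 0 then n - 1 else r - 1))
           + c * (\<Sum>r<n. circ_inv_coeff n a b c (Suc r)) = (if r = 0 then 1 else 0)"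
proof -
  define y where "y = c - b"
  define q where "q = (if r = 0 then n - 1 else r - 1)"
  define \<alpha> where "\<alpha> = 1 / real n * (1 / (real n * c) + (real n - 1) / (2 * (c - b)))"
  have y: "a - c = y" "y \<noteq> 0" and n: "real n \<noteq> 0"
    using assms by (auto simp: y_def)
  have k: "circ_inv_coeff n a b c (Suc t) = \<alpha> - real t / (real n * y)" for t
    using assms(2) by (simp add: circ_inv_coeff_def \<alpha>_def y_def)
  have total: "(\<Sum>r<n. circ_inv_coeff n a b c (Suc r)) = 1 / (real n * c)"
    using assms by (intro sum_circ_inv_coeff_arith) auto
  have "real q - real r = (if r = 0 then real n - 1 else - 1)"
    using assms(1) by (auto simp: q_def of_nat_diff)
  moreover have "y * (\<alpha> - real r / (real n * y)) - y * (\<alpha> - real q / (real n * y))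
      + c * (1 / (real n * c)) = (real q - real r + 1) / real n"
    using y n assms(4) by (simp add: field_simps)
  ultimately have "y * (\<alpha> - real r / (real n * y)) - y * (\<alpha> - real q / (real n * y))
      + c * (1 / (real n * c)) = (if r = 0 then 1 else 0)"
    using n by simp
  then show ?thesis
    unfolding total unfolding k q_def[symmetric] y y_def[symmetric] .
qed

section \<open>The invertibility criterion\<close>

text \<open>Both summands of the second factor are nonnegative, and the sign term makes the second one
  \<open>0\<close> for even \<open>n\<close> and \<open>2 (c - b)\<^sup>2\<close> for odd \<open>n\<close>.\<close>

lemma criterion_zero_iff:
  fixes a b c :: real
  shows "(a + b + (real n - 2) * c) * ((a - b)^2 + (1 - (-1)^n) * (c - b)^2) = 0 \<longleftrightarrow>
    a + b + (real n - 2) * c = 0 \<or> a = b \<and> (even n \<or> c = b)"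
  by (cases "even n") (auto simp: add_nonneg_eq_0_iff)

lemma criterion_zero_imp_singular:
  fixes a b c :: real
  assumes n: "n \<ge> 3"
    and zero: "(a + b + (real n - 2) * c) * ((a - b)^2 + (1 - (-1)^n) * (c - b)^2) = 0"
  shows "\<not> invertible_mat (circ (a # b # replicate (n - 2) c))"
proof -
  have n2: "n \<ge> 2" using n by simp
  consider "a + b + (real n - 2) * c = 0" | "a = b" "even n" | "a = b" "c = b"
    using zero unfolding criterion_zero_iff by blast
  then show ?thesis
  proof cases
    case 1
    show ?thesis
      by (rule circ_two_const_singular[OF n2, where j = 0 and f = "\<lambda>_. 1"])
        (use n 1 in \<open>auto simp: algebra_simps\<close>)
  next
    case 2
    have total: "(\<Sum>l<n. (-1 :: real) ^ l) = 0"
      using power_diff_1_eq[of "-1 :: real" n] 2(2) by simp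
    have wrap: "(-1 :: real) ^ (Suc i mod n) = - ((-1) ^ i)" if "i < n" for i
    proof (cases "Suc i = n")
      case True
      then have "odd i" using 2(2) by auto
      then show ?thesis using True by simp
    qed (use that in auto)
    show ?thesis
      by (rule circ_two_const_singular[OF n2, where j = 0 and f = "\<lambda>l. (-1) ^ l"])
        (use n 2(1) in \<open>auto simp: total wrap algebra_simps\<close>)
  next
    case 3
    have total: "(\<Sum>l<n. (if l = 0 then 1 else 0) - (if l = 1 then 1 else 0 :: real)) = 0"
      using n by (simp add: sum_subtractf)
    show ?thesis
      by (rule circ_two_const_singular[OF n2, where j = 0
            and f = "\<lambda>l. (if l = 0 then 1 else 0) - (if l = 1 then 1 else 0)"])
        (use n 3 total in auto)
  qed
qed

lemma criterion_nonzero_imp_right_inverse: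
  fixes a b c :: real
  assumes n: "n \<ge> 3"
    and nz: "(a + b + (real n - 2) * c) * ((a - b)^2 + (1 - (-1)^n) * (c - b)^2) \<noteq> 0"
  shows "circ (a # b # replicate (n - 2) c) * circ (map (circ_inv_coeff n a b c) [1..<n + 1]) =
    1\<^sub>m n"
proof (rule circ_two_const_right_inverse)
  have cond: "a + b + (real n - 2) * c \<noteq> 0" "\<not> (a = b \<and> (even n \<or> c = b))"
    using nz unfolding criterion_zero_iff by auto
  fix r assume r: "r < n"
  have "(a - c) * circ_inv_coeff n a b c (Suc r)
           - (c - b) * circ_inv_coeff n a b c (Suc (if r = 0 then n - 1 else r - 1))
           + c * (\<Sum>r<n. circ_inv_coeff n a b c (Suc r)) = (if r = 0 then 1 else 0)"
  proof (cases "a = 2 * c - b")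
    case True
    have "c \<noteq> b" using cond True by auto
    \<comment> \<open>The row sum is \<open>n c\<close> here.\<close>
    moreover have "c \<noteq> 0" using cond True by auto
    ultimately show ?thesis using circ_inv_coeff_rec_arith[OF r True] by simp
  next
    case False
    have "(a - c) ^ n \<noteq> (c - b) ^ n"
    proof
      assume "(a - c) ^ n = (c - b) ^ n"
      moreover have "a - c \<noteq> c - b" using False by auto
      ultimately have "even n \<and> a - c = - (c - b)"
        using n by (intro real_power_eq_imp_opposite) auto
      then show False using cond by auto
    qed
    then show ?thesis using circ_inv_coeff_rec_generic[OF r False] cond by simp
  qed
  then show "(a - c) * map (circ_inv_coeff n a b c) [1..<n + 1] ! r
      - (c - b) * map (circ_inv_coeff n a b c) [1..<n + 1] ! (if r = 0 then n - 1 else r - 1)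
      + c * sum_list (map (circ_inv_coeff n a b c) [1..<n + 1]) = (if r = 0 then 1 else 0)"
    unfolding sum_list_circ_inv_coeff using r by (auto simp del: upt_Suc)
qed (use n in auto)

theorem theorem2p3:
  fixes n :: nat and a b c :: real
  assumes "n \<ge> 3"
  shows "(invertible_mat (circ (a # b # replicate (n - 2) c)) \<longleftrightarrow>
            (a + b + (real n - 2) * c) * ((a - b)^2 + (1 - (-1)^n) * (c - b)^2) \<noteq> 0) \<and>
         (invertible_mat (circ (a # b # replicate (n - 2) c)) \<longrightarrow>
            inverts_mat (circ (a # b # replicate (n - 2) c))
                        (circ (map (circ_inv_coeff n a b c) [1..<n + 1])) \<and>
            inverts_mat (circ (map (circ_inv_coeff n a b c) [1..<n + 1]))
                        (circ (a # b # replicate (n - 2) c)))"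
proof -
  let ?A = "circ (a # b # replicate (n - 2) c)"
  let ?K = "circ (map (circ_inv_coeff n a b c) [1..<n + 1])"
  let ?D = "(a + b + (real n - 2) * c) * ((a - b)^2 + (1 - (-1)^n) * (c - b)^2)"
  have A: "?A \<in> carrier_mat n n"
    using circ_carrier[of "a # b # replicate (n - 2) c"] assms by auto
  have K: "?K \<in> carrier_mat n n"
    using circ_carrier[of "map (circ_inv_coeff n a b c) [1..<n + 1]"] by (simp del: upt_Suc)
  have inverse: "inverts_mat ?A ?K \<and> inverts_mat ?K ?A" if "?D \<noteq> 0"
  proof -
    have AK: "?A * ?K = 1\<^sub>m n"
      using criterion_nonzero_imp_right_inverse[OF assms that] .
    have "?K * ?A = 1\<^sub>m n"
      using mat_mult_left_right_inverse[OF A K AK] .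
    then show ?thesis using AK A K by (auto simp: inverts_mat_def)
  qed
  have "?D \<noteq> 0" if "invertible_mat ?A"
    using that criterion_zero_imp_singular[OF assms] by blast
  moreover have "invertible_mat ?A" if "?D \<noteq> 0"
    using inverse[OF that] A unfolding invertible_mat_def by auto
  ultimately show ?thesis using inverse by blast
qed

end
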